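(* Let $q$ be a real number with $0<q<1$. If $s$ and $t$ are integers such that $s-1$ and $t-1$ are positive integers, then \begin{align*} \zeta[s]\zeta[t] &= \sum_{a=0}^{s-1}\,\sum_{b=0}^{s-1-a} \binom{a+t-1}{t-1}\binom{t-1}{b}(1-q)^b\,\zeta[t+a,s-a-b]\\ &\quad+ \sum_{a=0}^{t-1}\,\sum_{b=0}^{t-1-a} \binom{a+s-1}{s-1}\binom{s-1}{b}(1-q)^b\,\zeta[s+a,t-a-b]\\ &\quad- \sum_{j=1}^{\min(s,t)}\frac{(s+t-j-1)!}{(s-j)!\,(t-j)!}\cdot \frac{(1-q)^j}{(j-1)!}\,\varphi[s+t-j]. \end{align*}
   Context: Fix a real number $q$ with $0<q<1$. For a positive integer $k$, put $[k]_q := \sum_{j=0}^{k-1} q^j = \frac{1-q^k}{1-q}$. For integers $s>1$ and $t\ge 1$ define the (convergent) series $$\zeta[s] := \sum_{n=1}^\infty \frac{q^{(s-1)n}}{[n]_q^s},\qquad \zeta[s,t] := \sum_{n>k>0}\frac{q^{(s-1)n}\,q^{(t-1)k}}{[n]_q^s\,[k]_q^t},$$ where the second sum is over all pairs of positive integers $n,k$ with $n>k$, and $$\varphi[s] := \sum_{n=1}^\infty \frac{(n-1)\,q^{(s-1)n}}{[n]_q^s}.$$ The binomial coefficient $\binom{m}{b}$ is $0$ when $b>m\ge 0$. *)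

theory Defs
  imports Complex_Main "HOL-Analysis.Infinite_Sum"
begin

definition qint :: "real \<Rightarrow> nat \<Rightarrow> real" where
  "qint q k = (\<Sum>j<k. q ^ j)"

text \<open>
  All series below have nonnegative terms for \<open>0 < q < 1\<close>, so the order of summation is irrelevant
  and unconditional summation agrees with the usual value of the series. They converge for
  \<open>s \<ge> 2\<close> and \<open>t \<ge> 1\<close>. The exponents \<open>s - 1\<close> and \<open>t - 1\<close> are truncated subtractions and are
  meaningful only for \<open>s, t \<ge> 1\<close>.
\<close>

definition qzeta :: "real \<Rightarrow> nat \<Rightarrow> real" where
  "qzeta q s = (\<Sum>\<^sub>\<infinity>n\<in>{1..}. q ^ ((s - 1) * n) / qint q n ^ s)"

definition qzeta2 :: "real \<Rightarrow> nat \<Rightarrow> nat \<Rightarrow> real" where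
  "qzeta2 q s t =
     (\<Sum>\<^sub>\<infinity>(n, k)\<in>{(n, k). n > k \<and> k > 0}.
        (q ^ ((s - 1) * n) * q ^ ((t - 1) * k)) / (qint q n ^ s * qint q k ^ t))"

definition qphi :: "real \<Rightarrow> nat \<Rightarrow> real" where
  "qphi q s = (\<Sum>\<^sub>\<infinity>n\<in>{1..}. (real n - 1) * q ^ ((s - 1) * n) / qint q n ^ s)"

end

theory Submission
  imports Defs "HOL-Analysis.Elementary_Metric_Spaces"
begin

text \<open>
  Write \<open>c = 1 - q\<close> and put \<open>\<alpha> = q^u/[u]\<close>, \<open>\<beta> = q^v/[v]\<close>, \<open>\<gamma> = q^(u+v)/[u+v]\<close>. Since
  \<open>1/[n] = q^n/[n] + c\<close>, the summand \<open>q^((s-1)u)/[u]^s\<close> equals \<open>\<alpha>^(s-1) (\<alpha> + c)\<close>, so the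
  product on the left and, after the substitutions described below, every series on the right is a
  sum over pairs \<open>u, v \<ge> 1\<close> of a polynomial in \<open>\<alpha>, \<beta>, \<gamma>\<close>.
  The addition rule \<open>[u+v] = [u] + q^u [v]\<close> becomes
  the single relation \<open>\<alpha> \<beta> = \<gamma> (\<alpha> + \<beta> + c)\<close>, and the decomposition is the termwise
  consequence of this relation: a partial fraction expansion of \<open>\<alpha>^S \<beta>^T (\<alpha> + \<beta> + c)\<close>
  with \<open>S = s - 1\<close> and \<open>T = t - 1\<close>.

  The expansion has three parts, and each of them, like the left-hand side, satisfies the lattice
  path recurrence
  \<open>F (S+1) (T+1) = \<gamma> (F S (T+1) + F (S+1) T + c F S T)\<close>.
  For the left-hand side the recurrence is the relation itself; for the three parts it comes from
  Pascal's rule (\<open>one_sided_part_recurrence\<close>, \<open>delannoy_recurrence\<close>). It therefore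
  suffices to compare the two sides on the axes \<open>S = 0\<close> and \<open>T = 0\<close>, where the relation is
  applied along a geometric progression (\<open>partial_fractions_axis\<close>).

  Summing over all pairs, the substitution \<open>n = u + v\<close>, \<open>k = u\<close> (or \<open>k = v\<close>) turns the two
  one-sided parts into double zeta values. The third part depends on \<open>u + v\<close> only; since there
  are \<open>n - 1\<close> pairs with \<open>u + v = n\<close>, it gives the values of \<open>\<phi>\<close>.
\<close>

section \<open>The partial fraction expansion\<close>

text \<open>The part of \<open>x^m (1 + c/x)^T\<close> that is polynomial in \<open>x\<close>. Raising \<open>T\<close> by one multiplies
  by \<open>1 + c/x\<close>, which is the recurrence \<open>truncated_binomial_Suc_Suc\<close>.\<close>

definition truncated_binomial :: "real \<Rightarrow> real \<Rightarrow> nat \<Rightarrow> nat \<Rightarrow> real" where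
  "truncated_binomial c x T m = (\<Sum>b\<le>m. real (T choose b) * c ^ b * x ^ (m - b))"

definition one_sided_part :: "real \<Rightarrow> real \<Rightarrow> real \<Rightarrow> nat \<Rightarrow> nat \<Rightarrow> real" where
  "one_sided_part c g x S T =
     (\<Sum>a\<le>S. real ((a + T) choose T) * g ^ (T + a) * truncated_binomial c x T (S - a))"

text \<open>The weighted Delannoy number: the sum over lattice paths from \<open>(0,0)\<close> to \<open>(S,T)\<close> with unit
  steps of weight \<open>g\<close> and diagonal steps of weight \<open>c * g\<close>; the index \<open>i\<close> counts diagonal steps.
  The first binomial coefficient vanishes when \<open>i > T\<close>.\<close>

definition delannoy :: "real \<Rightarrow> real \<Rightarrow> nat \<Rightarrow> nat \<Rightarrow> real" where
  "delannoy c g S T =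
     (\<Sum>i\<le>S. real ((S + T - i) choose S) * real (S choose i) * c ^ i * g ^ (S + T - i))"

lemma truncated_binomial_0 [simp]: "truncated_binomial c x T 0 = 1"
  by (simp add: truncated_binomial_def)

lemma truncated_binomial_0_left [simp]: "truncated_binomial c x 0 m = x ^ m"
proof -
  have "truncated_binomial c x 0 m = (\<Sum>b\<le>m. if b = 0 then x ^ m else 0)"
    unfolding truncated_binomial_def by (intro sum.cong) (auto simp: binomial_eq_0)
  then show ?thesis by simp
qed

lemma truncated_binomial_Suc_Suc:
  "truncated_binomial c x (Suc T) (Suc m) =
     truncated_binomial c x T (Suc m) + c * truncated_binomial c x T m"
  unfolding truncated_binomial_def
  by (simp add: sum.atMost_Suc_shift[of _ m] sum.distrib sum_distrib_left algebra_simps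
           del: sum.atMost_Suc)

text \<open>Pascal's rule for the outer binomial coefficient separates the step in \<open>S\<close> from the steps
  that lower \<open>T\<close>, and Pascal's rule for the truncated binomial separates the latter two.\<close>

lemma one_sided_part_recurrence:
  "one_sided_part c g x (Suc S) (Suc T) =
     g * (one_sided_part c g x S (Suc T) + one_sided_part c g x (Suc S) T
          + c * one_sided_part c g x S T)"
proof -
  let ?E = "truncated_binomial c x"
  have "one_sided_part c g x (Suc S) (Suc T) =
      (\<Sum>a\<le>Suc S. real ((a + T) choose T) * g ^ (Suc T + a) * ?E (Suc T) (Suc S - a))
    + (\<Sum>a\<le>Suc S. real ((a + T) choose Suc T) * g ^ (Suc T + a) * ?E (Suc T) (Suc S - a))"
    by (simp add: one_sided_part_def sum.distrib[symmetric] algebra_simps del: sum.atMost_Suc)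
  also have "(\<Sum>a\<le>Suc S. real ((a + T) choose Suc T) * g ^ (Suc T + a) * ?E (Suc T) (Suc S - a))
      = g * one_sided_part c g x S (Suc T)"
    by (simp add: one_sided_part_def sum.atMost_Suc_shift sum_distrib_left algebra_simps
          binomial_eq_0 del: sum.atMost_Suc binomial_Suc_Suc)
  also have "(\<Sum>a\<le>Suc S. real ((a + T) choose T) * g ^ (Suc T + a) * ?E (Suc T) (Suc S - a)) =
      g * one_sided_part c g x (Suc S) T + g * c * one_sided_part c g x S T"
  proof -
    have E: "?E (Suc T) (Suc S - a) = ?E T (Suc S - a) + c * ?E T (S - a)" if "a \<le> S" for a
      using that by (simp add: Suc_diff_le truncated_binomial_Suc_Suc)
    have "(\<Sum>a\<le>S. real ((a + T) choose T) * g ^ (Suc T + a) * ?E (Suc T) (Suc S - a)) =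
      (\<Sum>a\<le>S. real ((a + T) choose T) * g ^ (Suc T + a) * (?E T (Suc S - a) + c * ?E T (S - a)))"
      by (intro sum.cong) (auto simp: E)
    then show ?thesis
      by (simp add: one_sided_part_def sum.distrib sum_distrib_left algebra_simps)
  qed
  finally show ?thesis by (simp add: algebra_simps)
qed

text \<open>The last step of a path is horizontal, vertical or diagonal. In terms of coefficients, one
  use of Pascal's rule in each of the two binomial coefficients produces the three cases.\<close>

lemma delannoy_recurrence:
  "delannoy c g (Suc S) (Suc T) =
     g * (delannoy c g S (Suc T) + delannoy c g (Suc S) T + c * delannoy c g S T)"
proof -
  let ?w = "\<lambda>i. c ^ i * g ^ (Suc (Suc (S + T)) - i)"
  let ?N = "\<lambda>i. Suc (S + T) - i"
  have pascal: "(Suc (Suc (S + T)) - i) choose Suc S = (?N i choose S) + (?N i choose Suc S)"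
    if "i \<le> Suc S" for i
    using that by (simp add: Suc_diff_le)
  have "delannoy c g (Suc S) (Suc T) =
      (\<Sum>i\<le>Suc S. real (?N i choose S) * real (Suc S choose i) * ?w i)
    + (\<Sum>i\<le>Suc S. real (?N i choose Suc S) * real (Suc S choose i) * ?w i)"
    unfolding delannoy_def sum.distrib[symmetric]
    by (intro sum.cong) (auto simp: pascal algebra_simps simp del: binomial_Suc_Suc)
  also have "(\<Sum>i\<le>Suc S. real (?N i choose Suc S) * real (Suc S choose i) * ?w i)
      = g * delannoy c g (Suc S) T"
    unfolding delannoy_def sum_distrib_left
    by (intro sum.cong) (auto simp: Suc_diff_le simp del: binomial_Suc_Suc)
  also have "(\<Sum>i\<le>Suc S. real (?N i choose S) * real (Suc S choose i) * ?w i) =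
      (\<Sum>i\<le>Suc S. real (?N i choose S) * real (S choose i) * ?w i)
      + (\<Sum>i\<le>S. real (?N (Suc i) choose S) * real (S choose i) * ?w (Suc i))"
    by (simp add: sum.atMost_Suc_shift[of _ S] sum.distrib[symmetric] algebra_simps
          del: sum.atMost_Suc)
  also have "(\<Sum>i\<le>Suc S. real (?N i choose S) * real (S choose i) * ?w i)
      = g * delannoy c g S (Suc T)"
    by (simp add: delannoy_def sum_distrib_left binomial_eq_0 Suc_diff_le algebra_simps)
  also have "(\<Sum>i\<le>S. real (?N (Suc i) choose S) * real (S choose i) * ?w (Suc i))
      = g * c * delannoy c g S T"
    unfolding delannoy_def sum_distrib_left
    by (intro sum.cong) (auto simp: Suc_diff_le)
  finally show ?thesis by (simp add: algebra_simps)
qed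

lemma delannoy_0_left [simp]: "delannoy c g 0 T = g ^ T"
  by (simp add: delannoy_def)

lemma delannoy_0_right [simp]: "delannoy c g S 0 = g ^ S"
proof -
  have "delannoy c g S 0 = (\<Sum>i\<le>S. if i = 0 then g ^ S else 0)"
    unfolding delannoy_def by (intro sum.cong) (auto simp: binomial_eq_0)
  then show ?thesis by simp
qed

lemma one_sided_part_0_left [simp]: "one_sided_part c g x 0 T = g ^ T"
  by (simp add: one_sided_part_def)

lemma one_sided_part_0_right_Suc:
  "one_sided_part c g x (Suc S) 0 = x * one_sided_part c g x S 0 + g ^ Suc S"
proof -
  have "(\<Sum>a\<le>S. g ^ a * x ^ (Suc S - a)) = (\<Sum>a\<le>S. x * (g ^ a * x ^ (S - a)))"
    by (intro sum.cong) (auto simp: Suc_diff_le)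
  then show ?thesis by (simp add: one_sided_part_def sum_distrib_left)
qed

text \<open>On the axis, \<open>x y\<close> can be replaced by \<open>g (x + y + c)\<close> in the term \<open>x^S y\<close>; this leaves
  \<open>g x^(S-1) (x + c)\<close> and the same term with \<open>S\<close> lowered and a factor \<open>g\<close>.\<close>

lemma partial_fractions_axis:
  fixes c g x y :: real
  assumes "x * y = g * (x + y + c)"
  shows "x ^ S * (x + y + c) = one_sided_part c g x S 0 * (x + c) + g ^ S * y"
proof (induction S)
  case 0
  show ?case by simp
next
  case (Suc S)
  have "x ^ Suc S * (x + y + c) = x * (x ^ S * (x + y + c))" by simp
  also have "\<dots> = x * one_sided_part c g x S 0 * (x + c) + g ^ S * (x * y)"
    by (simp only: Suc.IH) (simp add: algebra_simps)
  also have "\<dots> = one_sided_part c g x (Suc S) 0 * (x + c) + g ^ Suc S * y"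
    by (simp only: assms one_sided_part_0_right_Suc) (simp add: algebra_simps)
  finally show ?case .
qed

text \<open>Both sides satisfy the lattice path recurrence, so the values on the axes decide. On an axis
  one of the one-sided parts and the Delannoy number reduce to the same power of \<open>g\<close>,
  and the summand \<open>c\<close> cancels between them.\<close>

lemma partial_fractions:
  fixes c g x y :: real
  assumes rel: "x * y = g * (x + y + c)"
  shows "x ^ S * y ^ T * (x + y + c) =
    one_sided_part c g x S T * (x + c) + one_sided_part c g y T S * (y + c) - c * delannoy c g S T"
proof (induction "S + T" arbitrary: S T rule: less_induct)
  case less
  have rel': "y * x = g * (y + x + c)" using rel by (simp add: algebra_simps)
  show ?case
  proof (cases S)
    case 0
    with partial_fractions_axis[OF rel', of T] show ?thesis by (simp add: algebra_simps)
  next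
    case S: (Suc S')
    show ?thesis
    proof (cases T)
      case 0
      with partial_fractions_axis[OF rel, of S] show ?thesis by (simp add: algebra_simps)
    next
      case T: (Suc T')
      let ?L = "\<lambda>S T. x ^ S * y ^ T * (x + y + c)"
      let ?R = "\<lambda>S T. one_sided_part c g x S T * (x + c) + one_sided_part c g y T S * (y + c)
                       - c * delannoy c g S T"
      have "?L S T = x ^ S' * y ^ T' * (x * y) * (x + y + c)"
        by (simp add: S T)
      also have "\<dots> = g * (?L S' T + ?L S T' + c * ?L S' T')"
        by (simp only: rel) (simp add: S T algebra_simps)
      also have "\<dots> = g * (?R S' T + ?R S T' + c * ?R S' T')"
        using less[of S' T] less[of S T'] less[of S' T'] by (simp add: S T)
      also have "\<dots> = ?R S T"
        by (simp only: S T one_sided_part_recurrence delannoy_recurrence) (simp add: algebra_simps)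
      finally show ?thesis .
    qed
  qed
qed

text \<open>The product of the two binomial coefficients in a Delannoy number is a trinomial coefficient;
  \<open>j = i + 1\<close> absorbs the extra factor \<open>c\<close>.\<close>

lemma delannoy_factorial_form:
  assumes "s > 0" "t > 0"
  shows "c * delannoy c g (s - 1) (t - 1) =
    (\<Sum>j=1..min s t. fact (s + t - j - 1) / (fact (s - j) * fact (t - j))
        * (c ^ j / fact (j - 1)) * g ^ (s + t - j - 1))"
proof -
  obtain S T where st: "s = Suc S" "t = Suc T"
    using assms by (metis Suc_pred)
  have coeff: "real ((S + T - i) choose S) * real (S choose i) =
      fact (S + T - i) / (fact (S - i) * fact (T - i) * fact i)" if "i \<le> min S T" for i
  proof -
    have "S \<le> S + T - i" "i \<le> S" "S + T - i - S = T - i" using that by auto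
    then show ?thesis by (simp add: binomial_fact)
  qed
  have "c * delannoy c g S T =
      (\<Sum>i\<le>S. c * (real ((S + T - i) choose S) * real (S choose i) * c ^ i * g ^ (S + T - i)))"
    by (simp add: delannoy_def sum_distrib_left)
  also have "\<dots> = (\<Sum>i\<le>min S T.
      c * (real ((S + T - i) choose S) * real (S choose i) * c ^ i * g ^ (S + T - i)))"
    by (intro sum.mono_neutral_right) (auto simp: binomial_eq_0)
  also have "\<dots> = (\<Sum>i\<le>min S T. fact (S + T - i) / (fact (S - i) * fact (T - i))
        * (c ^ Suc i / fact i) * g ^ (S + T - i))"
    by (intro sum.cong refl) (simp add: coeff)
  also have "\<dots> = (\<Sum>j=1..min s t. fact (s + t - j - 1) / (fact (s - j) * fact (t - j))
        * (c ^ j / fact (j - 1)) * g ^ (s + t - j - 1))"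
    by (rule sum.reindex_bij_witness[of _ "\<lambda>j. j - 1" Suc]) (auto simp: st)
  finally show ?thesis by (simp add: st)
qed

section \<open>The summands\<close>

definition qterm :: "real \<Rightarrow> nat \<Rightarrow> nat \<Rightarrow> real" where
  "qterm q s n = q ^ ((s - 1) * n) / qint q n ^ s"

lemma qint_mult: "(1 - q) * qint q n = 1 - q ^ n"
  by (simp add: qint_def one_diff_power_eq)

lemma qint_ge_1:
  assumes "0 < q" "n > 0"
  shows "qint q n \<ge> 1"
proof -
  have "q ^ 0 \<le> (\<Sum>j<n. q ^ j)"
    using assms by (intro member_le_sum) auto
  then show ?thesis by (simp add: qint_def)
qed

lemma qterm_nonneg: "0 < q \<Longrightarrow> 0 \<le> qterm q s n"
  by (simp add: qterm_def qint_def sum_nonneg)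

lemma qterm_le:
  assumes "0 < q" "n > 0"
  shows "qterm q s n \<le> q ^ ((s - 1) * n)"
proof -
  have "qint q n ^ s \<ge> 1" using qint_ge_1[OF assms] by (simp add: one_le_power)
  then show ?thesis using assms by (simp add: qterm_def divide_le_eq mult_le_cancel_left1)
qed

lemma qterm_factor:
  assumes "0 < q" "n > 0" "s > 0"
  shows "qterm q s n = (q ^ n / qint q n) ^ (s - 1) * (q ^ n / qint q n + (1 - q))"
proof -
  have pos: "qint q n > 0" using qint_ge_1[OF assms(1,2)] by linarith
  obtain S where s: "s = Suc S" using assms(3) by (metis Suc_pred)
  have "q ^ n / qint q n + (1 - q) = 1 / qint q n"
    using pos qint_mult[of q n] by (simp add: field_simps)
  then show ?thesis
    using pos by (simp add: qterm_def s power_divide power_mult[symmetric] mult.commute)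
qed

text \<open>The relation \<open>\<alpha> \<beta> = \<gamma> (\<alpha> + \<beta> + c)\<close> is \<open>[u+v] = [u] + [v] - c [u] [v]\<close> after
  clearing denominators.\<close>

lemma qint_add_relation:
  assumes "0 < q" "q < 1" "u > 0" "v > 0"
  shows "(q ^ u / qint q u) * (q ^ v / qint q v) =
    q ^ (u + v) / qint q (u + v) * (q ^ u / qint q u + q ^ v / qint q v + (1 - q))"
proof -
  let ?x = "qint q u" and ?y = "qint q v" and ?z = "qint q (u + v)"
  have pos: "?x > 0" "?y > 0" "?z > 0"
    using qint_ge_1[of q u] qint_ge_1[of q v] qint_ge_1[of q "u + v"] assms by simp_all
  have qu: "q ^ u = 1 - (1 - q) * ?x" and qv: "q ^ v = 1 - (1 - q) * ?y"
    by (simp_all add: qint_mult)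
  have "(1 - q) * ?z = (1 - q) * (?x + ?y - (1 - q) * ?x * ?y)"
  proof -
    have "(1 - q) * ?z = 1 - q ^ u * q ^ v" by (simp add: qint_mult power_add)
    also have "\<dots> = (1 - q) * (?x + ?y - (1 - q) * ?x * ?y)"
      by (simp only: qu qv) (simp add: algebra_simps)
    finally show ?thesis .
  qed
  then have z: "?z = ?x + ?y - (1 - q) * ?x * ?y" using assms by simp
  have "q ^ u / ?x + q ^ v / ?y + (1 - q) = ?z / (?x * ?y)"
    using pos(1,2) by (simp only: qu qv z) (simp add: field_simps)
  then show ?thesis using pos by (simp add: power_add)
qed

lemma qterm_one_sided_part:
  assumes "0 < q" "u > 0" "v > 0" "s > 0" "t > 0"
  defines "x \<equiv> q ^ u / qint q u" and "g \<equiv> q ^ (u + v) / qint q (u + v)"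
  shows "one_sided_part (1 - q) g x (s - 1) (t - 1) * (x + (1 - q)) * (g + (1 - q)) =
    (\<Sum>a=0..s - 1. \<Sum>b=0..s - 1 - a.
         real ((a + t - 1) choose (t - 1)) * real ((t - 1) choose b) * (1 - q) ^ b
           * (qterm q (t + a) (u + v) * qterm q (s - a - b) u))"
proof -
  have "one_sided_part (1 - q) g x (s - 1) (t - 1) * (x + (1 - q)) * (g + (1 - q)) =
    (\<Sum>a=0..s - 1. \<Sum>b=0..s - 1 - a.
      real ((a + (t - 1)) choose (t - 1)) * g ^ (t - 1 + a) *
      (real ((t - 1) choose b) * (1 - q) ^ b * x ^ (s - 1 - a - b)) * (x + (1 - q)) * (g + (1 - q)))"
    by (simp add: one_sided_part_def truncated_binomial_def sum_distrib_left sum_distrib_right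
          atMost_atLeast0)
  also have "\<dots> = (\<Sum>a=0..s - 1. \<Sum>b=0..s - 1 - a.
         real ((a + t - 1) choose (t - 1)) * real ((t - 1) choose b) * (1 - q) ^ b
           * (qterm q (t + a) (u + v) * qterm q (s - a - b) u))"
  proof (intro sum.cong refl)
    fix a b assume ab: "a \<in> {0..s - 1}" "b \<in> {0..s - 1 - a}"
    have 1: "qterm q (t + a) (u + v) = g ^ (t - 1 + a) * (g + (1 - q))"
      using qterm_factor[of q "u + v" "t + a"] assms by (simp add: g_def)
    have "s - a - b > 0" "s - a - b - 1 = s - 1 - a - b" using ab assms(4) by auto
    with qterm_factor[of q u "s - a - b"] assms
    have 2: "qterm q (s - a - b) u = x ^ (s - 1 - a - b) * (x + (1 - q))"
      by (simp add: x_def)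
    have "a + (t - 1) = a + t - 1" using assms by simp
    then show "real ((a + (t - 1)) choose (t - 1)) * g ^ (t - 1 + a) *
      (real ((t - 1) choose b) * (1 - q) ^ b * x ^ (s - 1 - a - b)) * (x + (1 - q)) * (g + (1 - q)) =
       real ((a + t - 1) choose (t - 1)) * real ((t - 1) choose b) * (1 - q) ^ b
           * (qterm q (t + a) (u + v) * qterm q (s - a - b) u)"
      unfolding 1 2 by (simp add: mult_ac)
  qed
  finally show ?thesis .
qed

text \<open>The partial fraction expansion multiplied by \<open>\<gamma> + c\<close>, because
  \<open>(\<alpha> + c) (\<beta> + c) = (\<gamma> + c) (\<alpha> + \<beta> + c)\<close>.\<close>

lemma qterm_product:
  assumes "0 < q" "q < 1" "u > 0" "v > 0" "s > 0" "t > 0"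
  shows "qterm q s u * qterm q t v =
      (\<Sum>a=0..s - 1. \<Sum>b=0..s - 1 - a.
         real ((a + t - 1) choose (t - 1)) * real ((t - 1) choose b) * (1 - q) ^ b
           * (qterm q (t + a) (u + v) * qterm q (s - a - b) u))
    + (\<Sum>a=0..t - 1. \<Sum>b=0..t - 1 - a.
         real ((a + s - 1) choose (s - 1)) * real ((s - 1) choose b) * (1 - q) ^ b
           * (qterm q (s + a) (u + v) * qterm q (t - a - b) v))
    - (\<Sum>j=1..min s t.
         fact (s + t - j - 1) / (fact (s - j) * fact (t - j))
           * ((1 - q) ^ j / fact (j - 1)) * qterm q (s + t - j) (u + v))"
proof -
  define c x y g where "c = 1 - q" and "x = q ^ u / qint q u" and "y = q ^ v / qint q v"
    and "g = q ^ (u + v) / qint q (u + v)"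
  have rel: "x * y = g * (x + y + c)"
    using qint_add_relation[OF assms(1-4)] by (simp add: x_def y_def g_def c_def)
  then have rel2: "(x + c) * (y + c) = (x + y + c) * (g + c)" by (simp add: algebra_simps)
  have "qterm q s u * qterm q t v = x ^ (s - 1) * y ^ (t - 1) * ((x + c) * (y + c))"
    using assms by (simp add: qterm_factor x_def y_def c_def)
  also have "\<dots> = x ^ (s - 1) * y ^ (t - 1) * (x + y + c) * (g + c)"
    by (simp add: rel2)
  also have "\<dots> = one_sided_part c g x (s - 1) (t - 1) * (x + c) * (g + c)
      + one_sided_part c g y (t - 1) (s - 1) * (y + c) * (g + c)
      - c * delannoy c g (s - 1) (t - 1) * (g + c)"
    by (simp only: partial_fractions[OF rel]) (simp add: algebra_simps)
  also have "c * delannoy c g (s - 1) (t - 1) * (g + c) =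
     (\<Sum>j=1..min s t. fact (s + t - j - 1) / (fact (s - j) * fact (t - j))
        * (c ^ j / fact (j - 1)) * qterm q (s + t - j) (u + v))"
  proof -
    have "qterm q (s + t - j) (u + v) = g ^ (s + t - j - 1) * (g + c)"
      if "j \<in> {1..min s t}" for j
      using that assms qterm_factor[of q "u + v" "s + t - j"] by (simp add: g_def c_def)
    then show ?thesis
      unfolding delannoy_factorial_form[OF assms(5,6)] sum_distrib_right
      by (intro sum.cong refl) (simp only: mult.assoc)
  qed
  also have "one_sided_part c g x (s - 1) (t - 1) * (x + c) * (g + c) =
    (\<Sum>a=0..s - 1. \<Sum>b=0..s - 1 - a.
         real ((a + t - 1) choose (t - 1)) * real ((t - 1) choose b) * (1 - q) ^ b
           * (qterm q (t + a) (u + v) * qterm q (s - a - b) u))"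
    using qterm_one_sided_part[of q u v s t] assms by (simp add: x_def g_def c_def)
  also have "one_sided_part c g y (t - 1) (s - 1) * (y + c) * (g + c) =
    (\<Sum>a=0..t - 1. \<Sum>b=0..t - 1 - a.
         real ((a + s - 1) choose (s - 1)) * real ((s - 1) choose b) * (1 - q) ^ b
           * (qterm q (s + a) (u + v) * qterm q (t - a - b) v))"
    using qterm_one_sided_part[of q v u t s] assms
    by (simp add: y_def g_def c_def add.commute[of v u])
  finally show ?thesis by (simp add: c_def)
qed

section \<open>Summation over pairs\<close>

lemma power_summable_on:
  fixes q :: real
  assumes "0 < q" "q < 1"
  shows "(\<lambda>n. q ^ n) summable_on (A :: nat set)"
proof -
  have "summable (\<lambda>n. norm (q ^ n))" using assms by (simp add: summable_geometric)
  then have "(\<lambda>n. q ^ n) summable_on UNIV" by (rule norm_summable_imp_summable_on)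
  then show ?thesis by (rule summable_on_subset) auto
qed

lemma has_sum_times:
  fixes f :: "'a \<Rightarrow> real" and g :: "'b \<Rightarrow> real"
  assumes f: "(f has_sum F) A" and g: "(g has_sum G) B"
    and nonneg: "\<And>x. x \<in> A \<Longrightarrow> 0 \<le> f x" "\<And>y. y \<in> B \<Longrightarrow> 0 \<le> g y"
  shows "((\<lambda>(x, y). f x * g y) has_sum (F * G)) (A \<times> B)"
proof -
  have inner: "((\<lambda>y. (\<lambda>(x, y). f x * g y) (x, y)) has_sum (f x * G)) B" for x
    using has_sum_cmult_right[OF g] by simp
  have outer: "((\<lambda>x. f x * G) has_sum (F * G)) A"
    by (rule has_sum_cmult_left[OF f])
  have "(\<lambda>(x, y). f x * g y) summable_on (A \<times> B)"
  proof (rule summable_on_SigmaI)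
    show "(\<lambda>x. f x * G) summable_on A" using outer by (auto simp: summable_on_def)
  qed (use inner nonneg in auto)
  then show ?thesis
    using inner by (intro has_sum_SigmaI[OF _ outer]) auto
qed

lemma qterm_has_sum:
  assumes "0 < q" "q < 1" "s > 1"
  shows "(qterm q s has_sum qzeta q s) {1..}"
proof -
  have "qterm q s summable_on {1..}"
  proof (rule summable_on_comparison_test[OF power_summable_on[OF assms(1,2)]])
    fix n :: nat assume "n \<in> {1..}"
    then have "qterm q s n \<le> q ^ ((s - 1) * n)" using qterm_le assms by simp
    also have "\<dots> \<le> q ^ n" using assms by (intro power_decreasing) auto
    finally show "qterm q s n \<le> q ^ n" .
  qed (use assms qterm_nonneg in auto)
  then show ?thesis unfolding qzeta_def qterm_def[symmetric] by (rule has_sum_infsum)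
qed

text \<open>The term is at most \<open>q^(u+v) = q^u q^v\<close>, because \<open>s \<ge> 2\<close>; the second factor is
  bounded by \<open>1\<close>.\<close>

lemma qterm_sum_summable_on:
  assumes "0 < q" "q < 1" "s > 1"
    and h: "\<And>u v. u > 0 \<Longrightarrow> v > 0 \<Longrightarrow> 0 \<le> h u v \<and> h u v \<le> (1 :: real)"
  shows "(\<lambda>(u, v). qterm q s (u + v) * h u v) summable_on ({1..} \<times> {1..})"
proof -
  have geom: "(\<lambda>(u, v). q ^ u * q ^ v) summable_on ({1..} \<times> {1..} :: (nat \<times> nat) set)"
    using has_sum_times[OF has_sum_infsum has_sum_infsum, OF power_summable_on power_summable_on]
      assms unfolding summable_on_def by fastforce
  show ?thesis
  proof (rule summable_on_comparison_test[OF geom])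
    fix p :: "nat \<times> nat" assume p: "p \<in> {1..} \<times> {1..}"
    obtain u v where uv: "p = (u, v)" "u > 0" "v > 0" using p by (cases p) auto
    have "qterm q s (u + v) * h u v \<le> qterm q s (u + v)"
      using h[OF uv(2,3)] qterm_nonneg[OF assms(1)] by (simp add: mult_left_le)
    also have "\<dots> \<le> q ^ ((s - 1) * (u + v))" using qterm_le assms uv by simp
    also have "\<dots> \<le> q ^ (u + v)" using assms by (intro power_decreasing) auto
    finally show "(\<lambda>(u, v). qterm q s (u + v) * h u v) p \<le> (\<lambda>(u, v). q ^ u * q ^ v) p"
      by (simp add: uv power_add)
    show "0 \<le> (\<lambda>(u, v). qterm q s (u + v) * h u v) p"
      using h[OF uv(2,3)] qterm_nonneg[OF assms(1)] by (simp add: uv)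
  qed
qed

lemma bij_betw_sum_fst:
  "bij_betw (\<lambda>(u, v). (u + v, u)) ({1..} \<times> {1..}) {(n, k). n > k \<and> k > (0 :: nat)}"
  by (rule bij_betw_byWitness[where f' = "\<lambda>(n, k). (k, n - k)"]) auto

lemma qzeta2_has_sum:
  assumes "0 < q" "q < 1" "s > 1"
  shows "((\<lambda>(u, v). qterm q s (u + v) * qterm q t u) has_sum qzeta2 q s t) ({1..} \<times> {1..})"
proof -
  let ?f = "\<lambda>(n, k). qterm q s n * qterm q t k"
  have le1: "qterm q t u \<le> 1" if "u > 0" for u
  proof -
    have "qterm q t u \<le> q ^ ((t - 1) * u)" using qterm_le that assms by simp
    also have "\<dots> \<le> 1" using assms by (simp add: power_le_one)
    finally show ?thesis .
  qed
  have "(\<lambda>(u, v). qterm q s (u + v) * qterm q t u) summable_on ({1..} \<times> {1..})"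
    using qterm_sum_summable_on[OF assms, of "\<lambda>u v. qterm q t u"] le1 qterm_nonneg assms by simp
  then have "(\<lambda>p. ?f ((\<lambda>(u, v). (u + v, u)) p)) summable_on ({1..} \<times> {1..})"
    by (simp add: case_prod_unfold)
  then have "?f summable_on {(n, k). n > k \<and> k > 0}"
    using summable_on_reindex_bij_betw[OF bij_betw_sum_fst] by blast
  then have "(?f has_sum qzeta2 q s t) {(n, k). n > k \<and> k > 0}"
    unfolding qzeta2_def by (simp add: qterm_def)
  then have "((\<lambda>p. ?f ((\<lambda>(u, v). (u + v, u)) p)) has_sum qzeta2 q s t) ({1..} \<times> {1..})"
    using has_sum_reindex_bij_betw[OF bij_betw_sum_fst] by blast
  then show ?thesis by (simp add: case_prod_unfold)
qed

lemma qzeta2_has_sum_swap: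
  assumes "0 < q" "q < 1" "s > 1"
  shows "((\<lambda>(u, v). qterm q s (u + v) * qterm q t v) has_sum qzeta2 q s t) ({1..} \<times> {1..})"
proof -
  have "((\<lambda>p. (\<lambda>(u, v). qterm q s (u + v) * qterm q t u) (prod.swap p)) has_sum qzeta2 q s t)
      ({1..} \<times> {1..})"
    using qzeta2_has_sum[OF assms]
    by (subst has_sum_reindex_bij_betw[where B = "{1..} \<times> {1..}"])
       (auto simp: bij_betw_def inj_on_def image_iff)
  then show ?thesis by (simp add: case_prod_unfold add.commute)
qed

text \<open>There are \<open>n - 1\<close> pairs \<open>u, v \<ge> 1\<close> with \<open>u + v = n\<close>, so grouping by \<open>n\<close> yields the
  factor \<open>n - 1\<close>.\<close>

lemma qphi_has_sum:
  assumes "0 < q" "q < 1" "s > 1"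
  shows "((\<lambda>(u, v). qterm q s (u + v)) has_sum qphi q s) ({1..} \<times> {1..})"
proof -
  let ?P = "{1..} \<times> {1..} :: (nat \<times> nat) set"
  have S: "(\<lambda>(u, v). qterm q s (u + v)) summable_on ?P"
    using qterm_sum_summable_on[OF assms, of "\<lambda>_ _. 1"] by simp
  then obtain I where I: "((\<lambda>(u, v). qterm q s (u + v)) has_sum I) ?P"
    by (auto simp: summable_on_def)
  have eq: "{(n, k). n > k \<and> k > (0 :: nat)} = Sigma {1..} (\<lambda>n. {1..<n})" by auto
  have "((\<lambda>p. (\<lambda>(n, k). qterm q s n) ((\<lambda>(u, v). (u + v, u)) p)) has_sum I) ?P"
    using I by (simp add: case_prod_unfold)
  then have "((\<lambda>(n, k). qterm q s n) has_sum I) (Sigma {1..} (\<lambda>n. {1..<n}))"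
    using has_sum_reindex_bij_betw[OF bij_betw_sum_fst] unfolding eq by blast
  moreover have "((\<lambda>k. (\<lambda>(n, k). qterm q s n) (n, k)) has_sum (real n - 1) * qterm q s n) {1..<n}"
    if "n \<in> {1..}" for n :: nat
    using that by (intro has_sum_finiteI) (auto simp: of_nat_diff)
  ultimately have "((\<lambda>n. (real n - 1) * qterm q s n) has_sum I) {1..}"
    by (rule has_sum_SigmaD[where f = "\<lambda>(n, k). qterm q s n"])
  then have "I = qphi q s"
    by (simp add: qphi_def qterm_def infsumI)
  with I show ?thesis by simp
qed

lemma has_sum_sum:
  fixes f :: "'i \<Rightarrow> 'a \<Rightarrow> 'b :: topological_comm_monoid_add"
  assumes "\<And>i. i \<in> I \<Longrightarrow> (f i has_sum F i) A"
  shows "((\<lambda>x. \<Sum>i\<in>I. f i x) has_sum (\<Sum>i\<in>I. F i)) A"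
  using assms by (induction I rule: infinite_finite_induct) (auto intro: has_sum_add)

theorem theorem1:
  fixes q :: real and s t :: nat
  assumes "0 < q" and "q < 1" and "s > 1" and "t > 1"
  shows "qzeta q s * qzeta q t =
      (\<Sum>a=0..s - 1. \<Sum>b=0..s - 1 - a.
         real ((a + t - 1) choose (t - 1)) * real ((t - 1) choose b) * (1 - q) ^ b
           * qzeta2 q (t + a) (s - a - b))
    + (\<Sum>a=0..t - 1. \<Sum>b=0..t - 1 - a.
         real ((a + s - 1) choose (s - 1)) * real ((s - 1) choose b) * (1 - q) ^ b
           * qzeta2 q (s + a) (t - a - b))
    - (\<Sum>j=1..min s t.
         fact (s + t - j - 1) / (fact (s - j) * fact (t - j))
           * ((1 - q) ^ j / fact (j - 1)) * qphi q (s + t - j))"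
    (is "_ = ?A + ?B - ?C")
proof -
  let ?P = "{1..} \<times> {1..} :: (nat \<times> nat) set"
  let ?a = "\<lambda>p. \<Sum>a=0..s - 1. \<Sum>b=0..s - 1 - a.
         real ((a + t - 1) choose (t - 1)) * real ((t - 1) choose b) * (1 - q) ^ b
           * (\<lambda>(u, v). qterm q (t + a) (u + v) * qterm q (s - a - b) u) p"
  let ?b = "\<lambda>p. \<Sum>a=0..t - 1. \<Sum>b=0..t - 1 - a.
         real ((a + s - 1) choose (s - 1)) * real ((s - 1) choose b) * (1 - q) ^ b
           * (\<lambda>(u, v). qterm q (s + a) (u + v) * qterm q (t - a - b) v) p"
  let ?c = "\<lambda>p. \<Sum>j=1..min s t.
         fact (s + t - j - 1) / (fact (s - j) * fact (t - j))
           * ((1 - q) ^ j / fact (j - 1)) * (\<lambda>(u, v). qterm q (s + t - j) (u + v)) p"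
  have "(?a has_sum ?A) ?P"
    using assms by (intro has_sum_sum has_sum_cmult_right qzeta2_has_sum) auto
  moreover have "(?b has_sum ?B) ?P"
    using assms by (intro has_sum_sum has_sum_cmult_right qzeta2_has_sum_swap) auto
  moreover have "(?c has_sum ?C) ?P"
    using assms by (intro has_sum_sum has_sum_cmult_right qphi_has_sum) auto
  ultimately have "((\<lambda>p. ?a p + ?b p + - ?c p) has_sum (?A + ?B + - ?C)) ?P"
    by (intro has_sum_add) (auto simp only: has_sum_uminus minus_minus)
  moreover have "?a p + ?b p + - ?c p = (\<lambda>(u, v). qterm q s u * qterm q t v) p"
    if "p \<in> ?P" for p
  proof (cases p)
    case (Pair u v)
    with that assms qterm_product[of q u v s t] show ?thesis by simp
  qed
  ultimately have "((\<lambda>(u, v). qterm q s u * qterm q t v) has_sum (?A + ?B + - ?C)) ?P"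
    by (subst (asm) has_sum_cong) auto
  moreover have "((\<lambda>(u, v). qterm q s u * qterm q t v) has_sum (qzeta q s * qzeta q t)) ?P"
    using assms by (intro has_sum_times qterm_has_sum qterm_nonneg)
  ultimately have "qzeta q s * qzeta q t = ?A + ?B + - ?C"
    by (rule has_sum_unique[rotated])
  then show ?thesis by simp
qed

end
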